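(* Let $G$ be a connected graph of order $n$. Then $\gamma_{rI}(G)=n$ if and only if $G$ is isomorphic to one of the graphs $K_1$, $K_{1,n-1}$ (with $n\ge 2$), $C_4$, $C_5$, $P_4$, $P_5$, $P_6$.
   Context: All graphs are finite and simple; $P_k$ and $C_k$ denote the path and the cycle on $k$ vertices. For $f:V(G)\to\{0,1,2\}$, the weight is $\omega(f)=\sum_{v\in V(G)}f(v)$ and $V_i=\{v: f(v)=i\}$. An Italian dominating function of $G$ is a function $f:V(G)\to\{0,1,2\}$ such that every $v$ with $f(v)=0$ satisfies $\sum_{u\in N(v)}f(u)\ge 2$. A restrained Italian dominating (RID) function is an Italian dominating function for which the induced subgraph $G[V_0]$ has no isolated vertices; $\gamma_{rI}(G)$ is the minimum weight of an RID function of $G$. *)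

theory Defs
  imports "Graph_Theory.Graph_Theory"
begin

text \<open>A finite simple graph is a \<^locale>\<open>pair_graph\<close>: an edge \<open>uv\<close> is represented by the two
  arcs \<open>(u, v)\<close> and \<open>(v, u)\<close>. \<^const>\<open>connected\<close> includes non-emptiness of the vertex set.\<close>

definition nbrs :: "'a pair_pre_digraph \<Rightarrow> 'a \<Rightarrow> 'a set" where
  "nbrs G v = {u. (v, u) \<in> parcs G}"

text \<open>Labellings are total on the type; only their values on the vertices matter.\<close>

definition italian_dominating :: "'a pair_pre_digraph \<Rightarrow> ('a \<Rightarrow> nat) \<Rightarrow> bool" where
  "italian_dominating G f \<longleftrightarrow>
     f ` pverts G \<subseteq> {0, 1, 2} \<and>
     (\<forall>v \<in> pverts G. f v = 0 \<longrightarrow> (\<Sum>u \<in> nbrs G v. f u) \<ge> 2)"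

definition level_set :: "'a pair_pre_digraph \<Rightarrow> ('a \<Rightarrow> nat) \<Rightarrow> nat \<Rightarrow> 'a set" where
  "level_set G f i = {v \<in> pverts G. f v = i}"

definition no_isolated_verts :: "('a, 'b) pre_digraph \<Rightarrow> bool" where
  "no_isolated_verts H \<longleftrightarrow> (\<forall>v \<in> verts H. \<exists>u. v \<rightarrow>\<^bsub>H\<^esub> u)"

definition restrained_italian_dominating :: "'a pair_pre_digraph \<Rightarrow> ('a \<Rightarrow> nat) \<Rightarrow> bool" where
  "restrained_italian_dominating G f \<longleftrightarrow>
     italian_dominating G f \<and> no_isolated_verts (with_proj G \<restriction> level_set G f 0)"

definition weight :: "'a pair_pre_digraph \<Rightarrow> ('a \<Rightarrow> nat) \<Rightarrow> nat" where
  "weight G f = (\<Sum>v \<in> pverts G. f v)"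

definition restrained_italian_number :: "'a pair_pre_digraph \<Rightarrow> nat" where
  "restrained_italian_number G =
     (LEAST w. \<exists>f. restrained_italian_dominating G f \<and> weight G f = w)"

text \<open>The minimum is over a non-empty set: labelling every vertex by 1 is always admissible.\<close>

lemma restrained_italian_dominating_const_1: "restrained_italian_dominating G (\<lambda>_. 1)"
  by (auto simp: restrained_italian_dominating_def italian_dominating_def no_isolated_verts_def
      level_set_def)

definition path_graph :: "nat \<Rightarrow> nat pair_pre_digraph" where
  "path_graph k = \<lparr> pverts = {..<k},
     parcs = {(i, j). i < k \<and> j < k \<and> (j = Suc i \<or> i = Suc j)} \<rparr>"

text \<open>Only meaningful for \<open>k \<ge> 3\<close>.\<close>

definition cycle_graph :: "nat \<Rightarrow> nat pair_pre_digraph" where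
  "cycle_graph k = \<lparr> pverts = {..<k},
     parcs = {(i, j). i < k \<and> j < k \<and> (j = Suc i mod k \<or> i = Suc j mod k)} \<rparr>"

definition graph_iso :: "'a pair_pre_digraph \<Rightarrow> 'b pair_pre_digraph \<Rightarrow> bool" where
  "graph_iso G H \<longleftrightarrow> digraph_iso (with_proj G) (with_proj H)"

end

theory Submission
  imports Defs
begin

text \<open>
  Compared with the constant labelling 1, a labelling has smaller weight iff it has more zeros than
  twos. An edge with one end of degree at least 3 and the other of degree at least 2 can be labelled
  by two zeros, at the price of at most one 2 on a further neighbour. If there is no such edge, then
  either all neighbours of some vertex are leaves and the graph is a star, or all degrees are at
  most 2 and the graph is a path or a cycle. In the latter case, a path on 7 vertices can be
  labelled 2002002, and the cycles \<open>C\<^sub>3\<close> and \<open>C\<^sub>6\<close> can be labelled 200 and 200200. A finite case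
  distinction on the positions of the zeros shows that the remaining small graphs have no better
  labelling, and in a star no vertex can be labelled 0.
\<close>

section \<open>Graph isomorphisms\<close>

text \<open>An isomorphism of digraphs carries maps on vertices, arcs, tails and heads. Arcs that
  are pairs of vertices leave only the vertex map to choose. The bijection runs from
  \<open>H\<close> to \<open>G\<close>, so for a path or cycle \<open>H\<close> it numbers the
  vertices of \<open>G\<close>, and labellings of \<open>G\<close> pull back along it.\<close>

lemma (in pair_wf_digraph) graph_iso_iff:
  assumes "pair_wf_digraph H"
  shows "graph_iso G H \<longleftrightarrow> (\<exists>g. bij_betw g (pverts H) (pverts G) \<and>
    (\<forall>i \<in> pverts H. \<forall>j \<in> pverts H. (g i, g j) \<in> parcs G \<longleftrightarrow> (i, j) \<in> parcs H))"
    (is "_ \<longleftrightarrow> ?R")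
proof
  assume "graph_iso G H"
  then obtain f where f: "digraph_isomorphism f" and H: "with_proj H = app_iso f (with_proj G)"
    by (auto simp: graph_iso_def digraph_iso_def)
  define h where "h = iso_verts f"
  have inj: "inj_on h (pverts G)"
    using f by (auto simp: digraph_isomorphism_def h_def)
  have vH: "pverts H = h ` pverts G"
    using arg_cong[OF H, of verts] by (simp add: h_def)
  \<comment> \<open>Tail and head of \<open>with_proj H\<close> are \<open>fst\<close> and
    \<open>snd\<close>, so the components of \<open>f\<close> for them are the projections, and the
    arc map is forced to act as \<open>h\<close> on both ends.\<close>
  have "tail (with_proj H) = iso_tail f" "head (with_proj H) = iso_head f"
    unfolding H by simp_all
  then have "iso_arcs f e = (h (fst e), h (snd e))" if "e \<in> parcs G" for e
    using f that by (auto simp: digraph_isomorphism_def h_def prod_eq_iff)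
  then have aH: "parcs H = (\<lambda>e. (h (fst e), h (snd e))) ` parcs G"
    using arg_cong[OF H, of arcs] by simp
  have "(the_inv_into (pverts G) h i, the_inv_into (pverts G) h j) \<in> parcs G \<longleftrightarrow> (i, j) \<in> parcs H"
    if ij: "i \<in> pverts H" "j \<in> pverts H" for i j
  proof -
    obtain u v where uv: "i = h u" "j = h v" "u \<in> pverts G" "v \<in> pverts G"
      using ij by (auto simp: vH)
    have "(h u, h v) \<in> parcs H \<longleftrightarrow> (u, v) \<in> parcs G"
    proof
      assume "(h u, h v) \<in> parcs H"
      then obtain x y where xy: "(x, y) \<in> parcs G" "h u = h x" "h v = h y"
        by (auto simp: aH)
      then have "u = x" "v = y"
        using inj_onD[OF inj] uv in_arcsD1[OF xy(1)] in_arcsD2[OF xy(1)] by blast+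
      then show "(u, v) \<in> parcs G"
        using xy by simp
    qed (force simp: aH)
    then show ?thesis
      using uv inj by (simp add: the_inv_into_f_f)
  qed
  moreover have "bij_betw (the_inv_into (pverts G) h) (pverts H) (pverts G)"
    using inj vH by (simp add: bij_betw_imageI bij_betw_the_inv_into)
  ultimately show ?R
    by blast
next
  assume ?R
  then obtain g where bij: "bij_betw g (pverts H) (pverts G)"
    and adj: "\<And>i j. i \<in> pverts H \<Longrightarrow> j \<in> pverts H \<Longrightarrow> (g i, g j) \<in> parcs G \<longleftrightarrow> (i, j) \<in> parcs H"
    by blast
  interpret H: pair_wf_digraph H by fact
  define h where "h = the_inv_into (pverts H) g"
  have bijh: "bij_betw h (pverts G) (pverts H)"
    unfolding h_def using bij by (rule bij_betw_the_inv_into)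
  have gh: "g (h u) = u" if "u \<in> pverts G" for u
    using bij that unfolding h_def by (simp add: bij_betw_def f_the_inv_into_f)
  have hg: "h (g i) = i" if "i \<in> pverts H" for i
    using bij that unfolding h_def by (simp add: bij_betw_def the_inv_into_f_f)
  have hin: "h u \<in> pverts H" if "u \<in> pverts G" for u
    using bijh that by (auto simp: bij_betw_def)
  have gin: "g i \<in> pverts G" if "i \<in> pverts H" for i
    using bij that by (auto simp: bij_betw_def)
  have adjh: "(h u, h v) \<in> parcs H" if "(u, v) \<in> parcs G" for u v
    using that adj[of "h u" "h v"] gh hin in_arcsD1[OF that] in_arcsD2[OF that] by simp
  define f :: "('a, 'a \<times> 'a, 'b, 'b \<times> 'b) digraph_isomorphism" where
    "f = \<lparr> iso_verts = h, iso_arcs = map_prod h h, iso_head = snd, iso_tail = fst \<rparr>"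
  have inj: "inj_on h (pverts G)"
    using bijh by (simp add: bij_betw_def)
  have "inj_on (map_prod h h) (parcs G)"
    using map_prod_inj_on[OF inj inj] by (rule inj_on_subset) (auto dest: in_arcsD1 in_arcsD2)
  then have "digraph_isomorphism f"
    using inj wf_digraph_axioms by (simp add: digraph_isomorphism_def f_def)
  moreover have "with_proj H = app_iso f (with_proj G)"
  proof -
    have "pverts H = h ` pverts G"
      using bijh by (simp add: bij_betw_def)
    moreover have "(i, j) \<in> map_prod h h ` parcs G" if ij: "(i, j) \<in> parcs H" for i j
    proof -
      have "i \<in> pverts H" "j \<in> pverts H"
        using ij by (auto dest: H.in_arcsD1 H.in_arcsD2)
      then have "(g i, g j) \<in> parcs G" "(i, j) = map_prod h h (g i, g j)"
        using ij adj hg by auto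
      then show ?thesis
        by (rule rev_image_eqI)
    qed
    then have "parcs H = map_prod h h ` parcs G"
      using adjh by auto
    ultimately show ?thesis
      by (simp add: with_proj_def app_iso_def f_def)
  qed
  ultimately show "graph_iso G H"
    unfolding graph_iso_def digraph_iso_def by blast
qed

lemma pair_wf_digraph_path_graph: "pair_wf_digraph (path_graph k)"
  by unfold_locales (auto simp: path_graph_def)

lemma pair_wf_digraph_cycle_graph: "pair_wf_digraph (cycle_graph k)"
  by unfold_locales (auto simp: cycle_graph_def)

section \<open>Restrained Italian domination\<close>

text \<open>Neighbours are vertices by well-formedness, so being non-isolated in the subgraph
  induced by label 0 just means having a neighbour labelled 0.\<close>

lemma (in pair_wf_digraph) restrained_italian_dominating_iff:
  "restrained_italian_dominating G f \<longleftrightarrow>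
    (\<forall>v \<in> pverts G. f v \<le> 2 \<and>
      (f v = 0 \<longrightarrow> 2 \<le> sum f (nbrs G v) \<and> (\<exists>u \<in> nbrs G v. f u = 0)))"
proof -
  have "no_isolated_verts (with_proj G \<restriction> level_set G f 0) \<longleftrightarrow>
      (\<forall>v \<in> pverts G. f v = 0 \<longrightarrow> (\<exists>u \<in> nbrs G v. f u = 0))"
    by (fastforce simp: no_isolated_verts_def level_set_def nbrs_def arcs_ends_conv
        dest: in_arcsD2)
  moreover have "f ` pverts G \<subseteq> {0, 1, 2} \<longleftrightarrow> (\<forall>v \<in> pverts G. f v \<le> 2)"
    by (auto simp: image_subset_iff le_Suc_eq numeral_2_eq_2)
  ultimately show ?thesis
    by (auto simp: restrained_italian_dominating_def italian_dominating_def)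
qed

lemma restrained_italian_number_le:
  "restrained_italian_dominating G f \<Longrightarrow> restrained_italian_number G \<le> weight G f"
  unfolding restrained_italian_number_def by (rule Least_le) blast

lemma restrained_italian_number_le_card: "restrained_italian_number G \<le> card (pverts G)"
  using restrained_italian_number_le[OF restrained_italian_dominating_const_1[of G]]
  by (simp add: weight_def)

text \<open>The minimum is attained, because the constant labelling 1 is admissible.\<close>

lemma restrained_italian_number_geI:
  assumes "\<And>f. restrained_italian_dominating G f \<Longrightarrow> m \<le> weight G f"
  shows "m \<le> restrained_italian_number G"
proof -
  have "\<exists>f. restrained_italian_dominating G f \<and> weight G f = restrained_italian_number G"
    unfolding restrained_italian_number_def
    by (rule LeastI_ex) (use restrained_italian_dominating_const_1 in blast)
  then show ?thesis
    using assms by metis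
qed

text \<open>Composing a labelling of \<open>G\<close> with the vertex bijection gives an admissible
  labelling of \<open>H\<close> of the same weight. This carries lower bounds from concrete paths
  and cycles over to \<open>G\<close>.\<close>

lemma (in pair_wf_digraph) graph_iso_restrained_italian_number_le:
  assumes "pair_wf_digraph H" "graph_iso G H"
  shows "restrained_italian_number H \<le> restrained_italian_number G"
proof (rule restrained_italian_number_geI)
  fix f assume f: "restrained_italian_dominating G f"
  interpret H: pair_wf_digraph H by fact
  obtain g where bij: "bij_betw g (pverts H) (pverts G)"
    and adj: "\<And>i j. i \<in> pverts H \<Longrightarrow> j \<in> pverts H \<Longrightarrow> (g i, g j) \<in> parcs G \<longleftrightarrow> (i, j) \<in> parcs H"
    using assms graph_iso_iff by blast
  have img: "g ` pverts H = pverts G" and inj: "inj_on g (pverts H)"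
    using bij by (auto simp: bij_betw_def)
  have nbrs: "nbrs G (g i) = g ` nbrs H i" if "i \<in> pverts H" for i
  proof -
    have "u \<in> g ` nbrs H i" if u: "(g i, u) \<in> parcs G" for u
    proof -
      obtain j where "j \<in> pverts H" "u = g j"
        using in_arcsD2[OF u] img by blast
      then show ?thesis
        using u adj \<open>i \<in> pverts H\<close> by (auto simp: nbrs_def)
    qed
    then show ?thesis
      using that adj by (auto simp: nbrs_def dest: H.in_arcsD2)
  qed
  have sum_nbrs: "sum f (nbrs G (g i)) = sum (f \<circ> g) (nbrs H i)" if "i \<in> pverts H" for i
  proof -
    have "inj_on g (nbrs H i)"
      using inj by (rule inj_on_subset) (auto simp: nbrs_def dest: H.in_arcsD2)
    then show ?thesis
      by (simp add: nbrs that sum.reindex)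
  qed
  have "restrained_italian_dominating H (f \<circ> g)"
    unfolding H.restrained_italian_dominating_iff
  proof (intro ballI)
    fix i assume i: "i \<in> pverts H"
    then have "g i \<in> pverts G"
      using img by blast
    then have "f (g i) \<le> 2 \<and> (f (g i) = 0 \<longrightarrow>
        2 \<le> sum f (nbrs G (g i)) \<and> (\<exists>u \<in> nbrs G (g i). f u = 0))"
      using f by (simp add: restrained_italian_dominating_iff)
    then show "(f \<circ> g) i \<le> 2 \<and> ((f \<circ> g) i = 0 \<longrightarrow>
        2 \<le> sum (f \<circ> g) (nbrs H i) \<and> (\<exists>u \<in> nbrs H i. (f \<circ> g) u = 0))"
      using sum_nbrs[OF i] nbrs[OF i] by simp
  qed
  moreover have "weight H (f \<circ> g) = weight G f"
    unfolding weight_def img[symmetric] by (simp add: sum.reindex inj)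
  ultimately show "restrained_italian_number H \<le> weight G f"
    using restrained_italian_number_le by metis
qed

section \<open>The extremal graphs\<close>

lemma weight_ge_card:
  assumes "\<And>v. v \<in> pverts G \<Longrightarrow> f v \<noteq> 0"
  shows "card (pverts G) \<le> weight G f"
proof -
  have "(\<Sum>v \<in> pverts G. 1) \<le> weight G f"
    unfolding weight_def by (rule sum_mono) (use assms in \<open>simp add: Suc_le_eq\<close>)
  then show ?thesis
    by simp
qed

context pair_graph
begin

lemma restrained_italian_number_complete_1:
  assumes "K\<^bsub>1\<^esub> (with_proj G)"
  shows "card (pverts G) \<le> restrained_italian_number G"
proof (intro restrained_italian_number_geI weight_ge_card)
  obtain c where "pverts G = {c}"
    using assms by (auto simp: complete_digraph_pair_def card_1_singleton_iff)
  then have "nbrs G v = {}" if "v \<in> pverts G" for v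
    using that by (auto simp: nbrs_def dest: in_arcsD2 no_loops')
  then show "f v \<noteq> 0" if "restrained_italian_dominating G f" "v \<in> pverts G" for f v
    using that by (auto simp: restrained_italian_dominating_iff)
qed

text \<open>A leaf labelled 0 would need its only neighbour, the centre, to be labelled 0 and to
  contribute 2 at once. So no leaf is labelled 0, and then the centre has no neighbour labelled 0
  and cannot be labelled 0 either.\<close>

lemma restrained_italian_number_star:
  assumes "K\<^bsub>1,m\<^esub> (with_proj G)"
  shows "card (pverts G) \<le> restrained_italian_number G"
proof (intro restrained_italian_number_geI weight_ge_card)
  fix f v assume f: "restrained_italian_dominating G f" and v: "v \<in> pverts G"
  obtain c V where c: "pverts G = insert c V" "c \<notin> V" "parcs G = {c} \<times> V \<union> V \<times> {c}"
    using assms by (auto simp: complete_bipartite_digraph_pair_def card_1_singleton_iff)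
  have leaf: "f u \<noteq> 0" if "u \<in> V" for u
  proof -
    have "nbrs G u = {c}"
      using that c by (auto simp: nbrs_def)
    then show ?thesis
      using that c f by (auto simp: restrained_italian_dominating_iff)
  qed
  have "nbrs G c = V"
    using c by (auto simp: nbrs_def)
  then have "f c \<noteq> 0"
    using c f leaf by (auto simp: restrained_italian_dominating_iff)
  then show "f v \<noteq> 0"
    using leaf v c by auto
qed

end

section \<open>Lower bounds for small paths and cycles\<close>

lemma parcs_path_graph:
  "(i, j) \<in> parcs (path_graph k) \<longleftrightarrow> i < k \<and> j < k \<and> (j = Suc i \<or> i = Suc j)"
  by (simp add: path_graph_def)

lemma parcs_cycle_graph:
  "(i, j) \<in> parcs (cycle_graph k) \<longleftrightarrow> i < k \<and> j < k \<and>
     (j = Suc i \<or> i = Suc j \<or> i = 0 \<and> Suc j = k \<or> j = 0 \<and> Suc i = k)"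
  by (auto simp: cycle_graph_def mod_Suc)

text \<open>With at most two neighbours per vertex, a 0 needs one neighbour labelled 0 and the other
  labelled 2. Hence zeros come in adjacent pairs flanked by twos. Two such pairs take at least 7
  vertices of a path, so on up to 6 vertices at most one pair fits, and its two flanking twos make
  up for it. The script verifies this over all patterns of zeros.\<close>

lemma restrained_italian_number_path_graph_4: "4 \<le> restrained_italian_number (path_graph 4)"
proof (rule restrained_italian_number_geI)
  fix f assume f: "restrained_italian_dominating (path_graph 4) f"
  have V: "pverts (path_graph 4) = {0, 1, 2, 3}"
    by (auto simp: path_graph_def)
  have "nbrs (path_graph 4) 0 = {1}" "nbrs (path_graph 4) 1 = {0, 2}"
    "nbrs (path_graph 4) 2 = {1, 3}" "nbrs (path_graph 4) 3 = {2}"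
    by (auto simp: nbrs_def parcs_path_graph)
  then show "4 \<le> weight (path_graph 4) f"
    using f
    unfolding pair_wf_digraph.restrained_italian_dominating_iff[OF pair_wf_digraph_path_graph]
      weight_def V
    by (cases "f 0 = 0"; cases "f 1 = 0"; cases "f 2 = 0"; cases "f 3 = 0"; auto)
qed

lemma restrained_italian_number_path_graph_5: "5 \<le> restrained_italian_number (path_graph 5)"
proof (rule restrained_italian_number_geI)
  fix f assume f: "restrained_italian_dominating (path_graph 5) f"
  have V: "pverts (path_graph 5) = {0, 1, 2, 3, 4}"
    by (auto simp: path_graph_def)
  have "nbrs (path_graph 5) 0 = {1}" "nbrs (path_graph 5) 1 = {0, 2}"
    "nbrs (path_graph 5) 2 = {1, 3}" "nbrs (path_graph 5) 3 = {2, 4}" "nbrs (path_graph 5) 4 = {3}"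
    by (auto simp: nbrs_def parcs_path_graph)
  then show "5 \<le> weight (path_graph 5) f"
    using f
    unfolding pair_wf_digraph.restrained_italian_dominating_iff[OF pair_wf_digraph_path_graph]
      weight_def V
    by (cases "f 0 = 0"; cases "f 1 = 0"; cases "f 2 = 0"; cases "f 3 = 0"; cases "f 4 = 0"; auto)
qed

lemma restrained_italian_number_path_graph_6: "6 \<le> restrained_italian_number (path_graph 6)"
proof (rule restrained_italian_number_geI)
  fix f assume f: "restrained_italian_dominating (path_graph 6) f"
  have V: "pverts (path_graph 6) = {0, 1, 2, 3, 4, 5}"
    by (auto simp: path_graph_def)
  have "nbrs (path_graph 6) 0 = {1}" "nbrs (path_graph 6) 1 = {0, 2}"
    "nbrs (path_graph 6) 2 = {1, 3}" "nbrs (path_graph 6) 3 = {2, 4}" "nbrs (path_graph 6) 4 = {3, 5}"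
    "nbrs (path_graph 6) 5 = {4}"
    by (auto simp: nbrs_def parcs_path_graph)
  then show "6 \<le> weight (path_graph 6) f"
    using f
    unfolding pair_wf_digraph.restrained_italian_dominating_iff[OF pair_wf_digraph_path_graph]
      weight_def V
    by (cases "f 0 = 0"; cases "f 1 = 0"; cases "f 2 = 0"; cases "f 3 = 0"; cases "f 4 = 0"; cases "f 5 = 0"; auto)
qed

text \<open>Here two pairs of zeros take at least 6 vertices. From 4 vertices on, the twos flanking
  a single pair are distinct and make up for it.\<close>

lemma restrained_italian_number_cycle_graph_4: "4 \<le> restrained_italian_number (cycle_graph 4)"
proof (rule restrained_italian_number_geI)
  fix f assume f: "restrained_italian_dominating (cycle_graph 4) f"
  have V: "pverts (cycle_graph 4) = {0, 1, 2, 3}"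
    by (auto simp: cycle_graph_def)
  have "nbrs (cycle_graph 4) 0 = {1, 3}" "nbrs (cycle_graph 4) 1 = {0, 2}"
    "nbrs (cycle_graph 4) 2 = {1, 3}" "nbrs (cycle_graph 4) 3 = {0, 2}"
    by (auto simp: nbrs_def parcs_cycle_graph)
  then show "4 \<le> weight (cycle_graph 4) f"
    using f
    unfolding pair_wf_digraph.restrained_italian_dominating_iff[OF pair_wf_digraph_cycle_graph]
      weight_def V
    by (cases "f 0 = 0"; cases "f 1 = 0"; cases "f 2 = 0"; cases "f 3 = 0"; auto)
qed

lemma restrained_italian_number_cycle_graph_5: "5 \<le> restrained_italian_number (cycle_graph 5)"
proof (rule restrained_italian_number_geI)
  fix f assume f: "restrained_italian_dominating (cycle_graph 5) f"
  have V: "pverts (cycle_graph 5) = {0, 1, 2, 3, 4}"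
    by (auto simp: cycle_graph_def)
  have "nbrs (cycle_graph 5) 0 = {1, 4}" "nbrs (cycle_graph 5) 1 = {0, 2}"
    "nbrs (cycle_graph 5) 2 = {1, 3}" "nbrs (cycle_graph 5) 3 = {2, 4}" "nbrs (cycle_graph 5) 4 = {0, 3}"
    by (auto simp: nbrs_def parcs_cycle_graph)
  then show "5 \<le> weight (cycle_graph 5) f"
    using f
    unfolding pair_wf_digraph.restrained_italian_dominating_iff[OF pair_wf_digraph_cycle_graph]
      weight_def V
    by (cases "f 0 = 0"; cases "f 1 = 0"; cases "f 2 = 0"; cases "f 3 = 0"; cases "f 4 = 0"; auto)
qed

section \<open>Labellings of weight less than the order\<close>

context pair_graph
begin

lemma finite_nbrs: "finite (nbrs G v)"
  by (rule finite_subset[OF _ pair_finite_verts]) (auto simp: nbrs_def dest: in_arcsD2)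

text \<open>Label \<open>Z\<close> by 0, \<open>T\<close> by 2 and all other vertices by 1.\<close>

lemma restrained_italian_number_lessI:
  assumes sub: "Z \<subseteq> pverts G" "T \<subseteq> pverts G" and disj: "Z \<inter> T = {}"
    and card: "card T < card Z"
    and restr: "\<And>z. z \<in> Z \<Longrightarrow> \<exists>u \<in> Z. (z, u) \<in> parcs G"
    and dom: "\<And>z. z \<in> Z \<Longrightarrow> (\<exists>t \<in> T. (z, t) \<in> parcs G) \<or> 2 \<le> card (nbrs G z - Z)"
  shows "restrained_italian_number G < card (pverts G)"
proof -
  define f :: "'a \<Rightarrow> nat" where "f v = (if v \<in> Z then 0 else if v \<in> T then 2 else 1)" for v
  have "2 \<le> sum f (nbrs G z)" if z: "z \<in> Z" for z
    using dom[OF z]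
  proof
    assume "\<exists>t \<in> T. (z, t) \<in> parcs G"
    then obtain t where t: "t \<in> T" "t \<in> nbrs G z"
      by (auto simp: nbrs_def)
    have "f t \<le> sum f (nbrs G z)"
      by (rule member_le_sum) (use t finite_nbrs in auto)
    moreover have "f t = 2"
      using t disj by (auto simp: f_def)
    ultimately show ?thesis
      by simp
  next
    \<comment> \<open>Every vertex outside \<open>Z\<close> has label at least 1.\<close>
    assume "2 \<le> card (nbrs G z - Z)"
    also have "\<dots> \<le> sum f (nbrs G z - Z)"
      using sum_mono[of "nbrs G z - Z" "\<lambda>_. 1" f] by (simp add: f_def)
    also have "\<dots> \<le> sum f (nbrs G z)"
      by (rule sum_mono2) (use finite_nbrs in auto)
    finally show ?thesis .
  qed
  moreover have "\<exists>u \<in> nbrs G z. f u = 0" if "z \<in> Z" for z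
    using restr[OF that] by (auto simp: nbrs_def f_def)
  ultimately have "restrained_italian_dominating G f"
    by (auto simp: restrained_italian_dominating_iff f_def)
  then have "restrained_italian_number G \<le> weight G f"
    by (rule restrained_italian_number_le)
  moreover have "weight G f < card (pverts G)"
  proof -
    \<comment> \<open>Summed over all vertices, this identity says that the weight plus
      \<open>card Z\<close> equals the order plus \<open>card T\<close>.\<close>
    have "f v + (if v \<in> Z then 1 else 0) = 1 + (if v \<in> T then 1 else 0)" for v
      using disj by (auto simp: f_def)
    then have "(\<Sum>v \<in> pverts G. f v + (if v \<in> Z then 1 else 0)) =
        (\<Sum>v \<in> pverts G. 1 + (if v \<in> T then 1 else 0))"
      by simp
    then have "weight G f + (\<Sum>v \<in> pverts G. if v \<in> Z then 1 else 0) =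
        (\<Sum>v \<in> pverts G. 1) + (\<Sum>v \<in> pverts G. if v \<in> T then 1 else 0)"
      unfolding weight_def sum.distrib .
    moreover have "pverts G \<inter> Z = Z" "pverts G \<inter> T = T"
      using sub by auto
    ultimately have "weight G f + card Z = card (pverts G) + card T"
      using pair_finite_verts
      by (simp add: sum.If_cases)
    then show ?thesis
      using card by simp
  qed
  ultimately show ?thesis
    by simp
qed

text \<open>Take \<open>Z = {u, v}\<close> and \<open>T = {w}\<close> for a neighbour
  \<open>w\<close> of \<open>v\<close> other than \<open>u\<close>. Then \<open>v\<close> is
  dominated by the 2 on \<open>w\<close>, and \<open>u\<close> by its two or more neighbours besides
  \<open>v\<close>, all of nonzero label.\<close>

lemma restrained_italian_number_less_edge:
  assumes uv: "(u, v) \<in> parcs G" and u: "3 \<le> card (nbrs G u)" and v: "2 \<le> card (nbrs G v)"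
  shows "restrained_italian_number G < card (pverts G)"
proof -
  have "\<not> nbrs G v \<subseteq> {u}"
    using v card_mono[of "{u}" "nbrs G v"] by auto
  then obtain w where w: "(v, w) \<in> parcs G" "w \<noteq> u"
    by (auto simp: nbrs_def)
  have ne: "u \<noteq> v" "w \<noteq> v"
    using uv w by (auto dest: no_loops')
  have N: "nbrs G u - {u, v} = nbrs G u - {v}"
    by (auto simp: nbrs_def dest: no_loops')
  have "card (nbrs G u) - 1 \<le> card (nbrs G u - {v})"
    by (simp add: card_Diff_singleton_if)
  then have "2 \<le> card (nbrs G u - {u, v})"
    unfolding N using u by linarith
  then have dom: "(\<exists>t \<in> {w}. (z, t) \<in> parcs G) \<or> 2 \<le> card (nbrs G z - {u, v})" if "z \<in> {u, v}" for z
    using that w by blast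
  show ?thesis
  proof (rule restrained_italian_number_lessI[OF _ _ _ _ _ dom])
    show "{u, v} \<subseteq> pverts G" "{w} \<subseteq> pverts G"
      using in_arcsD1[OF uv] in_arcsD2[OF uv] in_arcsD2[OF w(1)] by auto
    show "{u, v} \<inter> {w} = {}" "card {w} < card {u, v}"
      using ne w by auto
    show "\<exists>x \<in> {u, v}. (z, x) \<in> parcs G" if "z \<in> {u, v}" for z
      using that uv arcs_symmetric[OF uv] by blast
  qed
qed

section \<open>Stars, paths and cycles\<close>

text \<open>Induction along a walk that starts in \<open>S\<close>. It serves to show that a star,
  or a longest path, already contains all vertices.\<close>

lemma connected_closed_eq:
  assumes conn: "connected (with_proj G)" and S: "S \<subseteq> pverts G" "S \<noteq> {}"
    and closed: "\<And>u v. u \<in> S \<Longrightarrow> (u, v) \<in> parcs G \<Longrightarrow> v \<in> S"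
  shows "S = pverts G"
proof -
  obtain u where u: "u \<in> S"
    using S by blast
  have "v \<in> S" if v: "v \<in> pverts G" for v
  proof -
    \<comment> \<open>Connectedness refers to the symmetric closure of the arcs, which adds nothing
      in a symmetric graph.\<close>
    have "(parcs G)\<^sup>s = parcs G"
      by (auto simp: symcl_def intro: arcs_symmetric)
    then have "(u, v) \<in> rtrancl_on (pverts G) (parcs G)"
      using conn u v S by (auto simp: connected_conv)
    then show ?thesis
      by (induction rule: rtrancl_on_induct) (use u closed in auto)
  qed
  then show ?thesis
    using S by blast
qed

text \<open>Each neighbour of \<open>c\<close> has \<open>c\<close> as its only neighbour, so
  \<open>c\<close> and its neighbours form a set closed under adjacency, hence the whole
  graph.\<close>

lemma star_or_singleton:
  assumes conn: "connected (with_proj G)" and c: "c \<in> pverts G"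
    and leaves: "\<And>u. u \<in> nbrs G c \<Longrightarrow> card (nbrs G u) < 2"
  shows "K\<^bsub>1\<^esub> (with_proj G) \<or>
    2 \<le> card (pverts G) \<and> K\<^bsub>1,card (pverts G) - 1\<^esub> (with_proj G)"
proof -
  let ?N = "nbrs G c"
  have leaf: "nbrs G u = {c}" if u: "u \<in> ?N" for u
  proof -
    have "{c} \<subseteq> nbrs G u"
      using u by (auto simp: nbrs_def intro: arcs_symmetric)
    moreover have "card (nbrs G u) \<le> card {c}"
      using leaves[OF u] by simp
    ultimately show ?thesis
      using card_seteq[OF finite_nbrs] by metis
  qed
  have V: "insert c ?N = pverts G"
    by (rule connected_closed_eq[OF conn]) (use c leaf in \<open>auto simp: nbrs_def dest: in_arcsD2\<close>)
  have cN: "c \<notin> ?N"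
    by (auto simp: nbrs_def dest: no_loops')
  have E: "parcs G = {c} \<times> ?N \<union> ?N \<times> {c}"
  proof (intro set_eqI iffI)
    fix e assume e: "e \<in> parcs G"
    obtain x y where xy: "e = (x, y)"
      by fastforce
    have "x \<in> insert c ?N" "y \<in> nbrs G x"
      using e V by (auto simp: xy nbrs_def dest: in_arcsD1)
    then show "e \<in> {c} \<times> ?N \<union> ?N \<times> {c}"
      using leaf by (auto simp: xy)
  qed (auto simp: nbrs_def intro: arcs_symmetric)
  have n: "card (pverts G) = Suc (card ?N)"
    using cN finite_nbrs by (simp flip: V)
  show ?thesis
  proof (cases "?N = {}")
    case True
    then have "parcs G = {}" "pverts G = {c}"
      using E V by auto
    then show ?thesis
      by (auto simp: complete_digraph_pair_def)
  next
    case False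
    then have "2 \<le> card (pverts G)"
      using n finite_nbrs by (simp add: Suc_le_eq card_gt_0_iff)
    moreover have "K\<^bsub>1,card (pverts G) - 1\<^esub> (with_proj G)"
      unfolding complete_bipartite_digraph_pair_def
      by (intro conjI pair_finite_verts exI[of _ "{c}"] exI[of _ ?N]) (simp_all add: V cN E n)
    ultimately show ?thesis
      by blast
  qed
qed

section \<open>Longest paths in graphs of maximum degree 2\<close>

text \<open>A path as an injective numbering of its vertices from 0, matching the vertices of
  \<open>path_graph k\<close>. The path need not be induced, and values of \<open>g\<close> from
  \<open>k\<close> on are arbitrary.\<close>

definition path_map :: "nat \<Rightarrow> (nat \<Rightarrow> 'a) \<Rightarrow> bool" where
  "path_map k g \<longleftrightarrow> inj_on g {..<k} \<and> g ` {..<k} \<subseteq> pverts G \<and>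
     (\<forall>i. Suc i < k \<longrightarrow> (g i, g (Suc i)) \<in> parcs G)"

lemma path_mapD:
  assumes "path_map k g"
  shows "i < k \<Longrightarrow> j < k \<Longrightarrow> g i = g j \<longleftrightarrow> i = j"
    and "i < k \<Longrightarrow> g i \<in> pverts G"
    and "Suc i < k \<Longrightarrow> (g i, g (Suc i)) \<in> parcs G"
    and "Suc i < k \<Longrightarrow> (g (Suc i), g i) \<in> parcs G"
  using assms by (auto simp: path_map_def inj_on_def intro: arcs_symmetric)

lemma path_map_snoc:
  assumes g: "path_map (Suc k) g" and w: "(g k, w) \<in> parcs G" "w \<notin> g ` {..<Suc k}"
  shows "path_map (Suc (Suc k)) (g(Suc k := w))"
proof -
  have "inj_on (g(Suc k := w)) {..<Suc (Suc k)}"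
    using g w(2) by (auto simp: path_map_def lessThan_Suc[of "Suc k"] inj_on_def)
  moreover have "(g(Suc k := w)) ` {..<Suc (Suc k)} \<subseteq> pverts G"
    using path_mapD(2)[OF g] in_arcsD2[OF w(1)] by auto
  ultimately show ?thesis
    using path_mapD(3)[OF g] w(1) by (auto simp: path_map_def less_Suc_eq)
qed

lemma path_map_rev:
  assumes g: "path_map (Suc k) g"
  shows "path_map (Suc k) (\<lambda>i. g (k - i))"
proof -
  have "inj_on (\<lambda>i. g (k - i)) {..<Suc k}"
    using path_mapD(1)[OF g] by (auto simp: inj_on_def)
  moreover have "(g (k - i), g (k - Suc i)) \<in> parcs G" if "Suc i < Suc k" for i
    using path_mapD(4)[OF g, of "k - Suc i"] that by (simp add: Suc_diff_Suc)
  ultimately show ?thesis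
    using path_mapD(2)[OF g] by (auto simp: path_map_def)
qed

lemma path_map_length_le: "path_map k g \<Longrightarrow> k \<le> card (pverts G)"
  using card_inj_on_le[of g "{..<k}" "pverts G"] pair_finite_verts by (auto simp: path_map_def)

text \<open>A single vertex is a path, and the order bounds all lengths. Writing the length as
  \<open>Suc m\<close> makes \<open>m\<close> the last index.\<close>

lemma obtain_longest_path_map:
  assumes "pverts G \<noteq> {}"
  obtains m g where "path_map (Suc m) g" "\<And>k h. path_map k h \<Longrightarrow> k \<le> Suc m"
proof -
  obtain v where "v \<in> pverts G"
    using assms by blast
  then have "\<exists>g. path_map 1 g"
    by (auto simp: path_map_def inj_on_def intro!: exI[of _ "\<lambda>_. v"])
  then obtain k where k: "\<exists>g. path_map k g" "\<And>j. \<exists>g. path_map j g \<Longrightarrow> j \<le> k" "1 \<le> k"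
    using GreatestI_nat[of "\<lambda>k. \<exists>g. path_map k g" 1 "card (pverts G)"]
      Greatest_le_nat[of "\<lambda>k. \<exists>g. path_map k g" _ "card (pverts G)"]
    by (metis path_map_length_le)
  then obtain m where "k = Suc m"
    by (cases k) auto
  then show ?thesis
    using k that by blast
qed

lemma nbrs_three:
  assumes "card (nbrs G v) \<le> 2" "(v, x) \<in> parcs G" "(v, y) \<in> parcs G" "(v, z) \<in> parcs G"
  shows "x = y \<or> x = z \<or> y = z"
proof (rule ccontr)
  assume "\<not> ?thesis"
  then have "card {x, y, z} = 3"
    by simp
  moreover have "card {x, y, z} \<le> card (nbrs G v)"
    by (rule card_mono[OF finite_nbrs]) (use assms in \<open>auto simp: nbrs_def\<close>)
  ultimately show False
    using assms(1) by simp
qed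

text \<open>On a longest path, maximality at the ends and the degree bound at inner vertices keep
  all neighbours on the path, so it spans the connected graph. By the degree bound again, the only
  possible further edge joins the two ends.\<close>

lemma path_or_cycle:
  assumes conn: "connected (with_proj G)"
    and deg: "\<And>v. v \<in> pverts G \<Longrightarrow> card (nbrs G v) \<le> 2"
  obtains k g where "0 < k" "path_map k g" "bij_betw g {..<k} (pverts G)"
    "(\<forall>i<k. \<forall>j<k. (g i, g j) \<in> parcs G \<longleftrightarrow> (i, j) \<in> parcs (path_graph k)) \<or>
     3 \<le> k \<and> (\<forall>i<k. \<forall>j<k. (g i, g j) \<in> parcs G \<longleftrightarrow> (i, j) \<in> parcs (cycle_graph k))"
proof -
  have "pverts G \<noteq> {}"
    using conn by (simp add: connected_conv)
  then obtain m g where g: "path_map (Suc m) g"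
    and max: "\<And>k h. path_map k h \<Longrightarrow> k \<le> Suc m"
    by (rule obtain_longest_path_map) blast
  note inj = path_mapD(1)[OF g] and in_V = path_mapD(2)[OF g] and
    step = path_mapD(3)[OF g] and step_rev = path_mapD(4)[OF g]
  let ?S = "g ` {..<Suc m}"
  have closed: "w \<in> ?S" if i: "i < Suc m" and w: "(g i, w) \<in> parcs G" for i w
  proof (rule ccontr)
    assume nw: "w \<notin> ?S"
    consider "i = m" | "i = 0" | l where "i = Suc l" "i < m"
      using i by (cases i) force+
    then show False
    proof cases
      case 1
      then show False
        using path_map_snoc[OF g, of w] w nw max by fastforce
    next
      case 2
      \<comment> \<open>The reversed path ends in \<open>g 0\<close> and could be extended there by
        \<open>w\<close>.\<close>
      have "w \<notin> (\<lambda>i. g (m - i)) ` {..<Suc m}"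
        using nw by auto
      then show False
        using path_map_snoc[OF path_map_rev[OF g], of w] w 2 max by fastforce
    next
      case 3
      \<comment> \<open>An inner vertex already has two neighbours on the path, so \<open>w\<close>
        would be a third.\<close>
      have "g l = g (Suc i) \<or> g l = w \<or> g (Suc i) = w"
        by (rule nbrs_three[of "g i"]) (use 3 step_rev step w deg in_V in auto)
      then show False
        using nw inj[of l "Suc i"] 3 by auto
    qed
  qed
  have V: "?S = pverts G"
    by (rule connected_closed_eq[OF conn]) (use in_V closed in auto)
  then have bij: "bij_betw g {..<Suc m} (pverts G)"
    using g by (simp add: bij_betw_def path_map_def)
  \<comment> \<open>If \<open>i\<close> or \<open>j\<close> were an inner index, the chord would
    give that vertex a third neighbour.\<close>
  have ends: "i = 0 \<and> j = m" if ij: "i < j" "j < Suc m" "j \<noteq> Suc i" and e: "(g i, g j) \<in> parcs G"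
    for i j
  proof (rule ccontr)
    assume "\<not> ?thesis"
    then consider l where "i = Suc l" | l where "j < m" "j = Suc l"
      using ij by (cases i; cases j) auto
    then show False
    proof cases
      case 1
      have "g l = g (Suc i) \<or> g l = g j \<or> g (Suc i) = g j"
        by (rule nbrs_three[of "g i"]) (use 1 ij e step_rev step deg in_V in auto)
      then show False
        using 1 ij inj by auto
    next
      case 2
      have "g l = g (Suc j) \<or> g l = g i \<or> g (Suc j) = g i"
        by (rule nbrs_three[of "g j"]) (use 2 ij arcs_symmetric[OF e] step_rev step deg in_V in auto)
      then show False
        using 2 ij inj by auto
    qed
  qed
  have loop: "(g i, g i) \<notin> parcs G" for i
    by (auto dest: no_loops')
  have adj: "(g i, g j) \<in> parcs G \<longleftrightarrow>
      j = Suc i \<or> i = Suc j \<or> (g 0, g m) \<in> parcs G \<and> (i = 0 \<and> j = m \<or> j = 0 \<and> i = m)"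
    if ij: "i < Suc m" "j < Suc m" for i j
  proof (cases i j rule: linorder_cases)
    case less
    then show ?thesis
      using ends[of i j] ij step[of i] by auto
  next
    case equal
    then show ?thesis
      using loop[of i] by auto
  next
    case greater
    have "(g i, g j) \<in> parcs G \<longleftrightarrow> (g j, g i) \<in> parcs G"
      by (auto intro: arcs_symmetric)
    then show ?thesis
      using greater ends[of j i] ij step[of j] by auto
  qed
  show thesis
  proof (cases "(g 0, g m) \<in> parcs G \<and> 2 \<le> m")
    case True
    then have "(g i, g j) \<in> parcs G \<longleftrightarrow> (i, j) \<in> parcs (cycle_graph (Suc m))"
      if "i < Suc m" "j < Suc m" for i j
      unfolding adj[OF that] parcs_cycle_graph using that by auto
    then show thesis
      using True by (intro that[OF _ g bij]) auto
  next
    case False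
    \<comment> \<open>For \<open>m = 0\<close> the closing edge would be a loop. For
      \<open>m = 1\<close> it is the edge of the path itself, so the graph counts as a path.\<close>
    then have "(g 0, g m) \<notin> parcs G \<or> m = 1"
      using loop[of 0] by (cases "m = 0") auto
    then have "(g i, g j) \<in> parcs G \<longleftrightarrow> (i, j) \<in> parcs (path_graph (Suc m))"
      if "i < Suc m" "j < Suc m" for i j
      unfolding adj[OF that] parcs_path_graph using that by auto
    then show thesis
      by (intro that[OF _ g bij]) auto
  qed
qed

section \<open>Cheap labellings of long paths and of two cycles\<close>

text \<open>The pattern 2002002 on \<open>g 0\<close> to \<open>g 6\<close> has four zeros and three
  twos. Further vertices and edges of the graph do no harm.\<close>

lemma restrained_italian_number_less_path_map:
  assumes g: "path_map k g" and k: "7 \<le> k"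
  shows "restrained_italian_number G < card (pverts G)"
proof (rule restrained_italian_number_lessI)
  let ?Z = "{g 1, g 2, g 4, g 5}" and ?T = "{g 0, g 3, g 6}"
  show "?Z \<subseteq> pverts G" "?T \<subseteq> pverts G"
    using path_mapD(2)[OF g] k by auto
  show "?Z \<inter> ?T = {}"
    using path_mapD(1)[OF g] k by auto
  show "card ?T < card ?Z"
    using path_mapD(1)[OF g] k by (simp add: card_insert_if)
  have "(g 1, g 0) \<in> parcs G" "(g 1, g 2) \<in> parcs G" "(g 2, g 1) \<in> parcs G" "(g 2, g 3) \<in> parcs G"
    "(g 4, g 3) \<in> parcs G" "(g 4, g 5) \<in> parcs G" "(g 5, g 4) \<in> parcs G" "(g 5, g 6) \<in> parcs G"
    using path_mapD(4)[OF g, of 0] path_mapD(3,4)[OF g, of 1] path_mapD(3)[OF g, of 2]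
      path_mapD(4)[OF g, of 3] path_mapD(3,4)[OF g, of 4] path_mapD(3)[OF g, of 5] k
    by (simp_all add: eval_nat_numeral)
  then show "\<exists>u \<in> ?Z. (z, u) \<in> parcs G"
    "(\<exists>t \<in> ?T. (z, t) \<in> parcs G) \<or> 2 \<le> card (nbrs G z - ?Z)" if "z \<in> ?Z" for z
    using that by auto
qed

text \<open>The closing edge lets the 2 on \<open>g 0\<close> serve both ends of the numbering, so
  one 2 per pair of zeros suffices.\<close>

lemma restrained_italian_number_less_cycle:
  assumes g: "path_map k g" and k: "k = 3 \<or> k = 6"
    and adj: "\<And>i j. i < k \<Longrightarrow> j < k \<Longrightarrow> (g i, g j) \<in> parcs G \<longleftrightarrow> (i, j) \<in> parcs (cycle_graph k)"
  shows "restrained_italian_number G < card (pverts G)"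
  using k
proof
  assume k: "k = 3"
  show ?thesis
  proof (rule restrained_italian_number_lessI)
    let ?Z = "{g 1, g 2}" and ?T = "{g 0}"
    show "?Z \<subseteq> pverts G" "?T \<subseteq> pverts G"
      using path_mapD(2)[OF g] k by auto
    show "?Z \<inter> ?T = {}"
      using path_mapD(1)[OF g] k by auto
    show "card ?T < card ?Z"
      using path_mapD(1)[OF g] k by (simp add: card_insert_if)
    have "(g 1, g 0) \<in> parcs G" "(g 1, g 2) \<in> parcs G" "(g 2, g 1) \<in> parcs G" "(g 2, g 0) \<in> parcs G"
      by (simp_all add: adj k parcs_cycle_graph)
    then show "\<exists>u \<in> ?Z. (z, u) \<in> parcs G"
      "(\<exists>t \<in> ?T. (z, t) \<in> parcs G) \<or> 2 \<le> card (nbrs G z - ?Z)" if "z \<in> ?Z" for z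
      using that by auto
  qed
next
  assume k: "k = 6"
  show ?thesis
  proof (rule restrained_italian_number_lessI)
    let ?Z = "{g 1, g 2, g 4, g 5}" and ?T = "{g 0, g 3}"
    show "?Z \<subseteq> pverts G" "?T \<subseteq> pverts G"
      using path_mapD(2)[OF g] k by auto
    show "?Z \<inter> ?T = {}"
      using path_mapD(1)[OF g] k by auto
    show "card ?T < card ?Z"
      using path_mapD(1)[OF g] k by (simp add: card_insert_if)
    have "(g 1, g 0) \<in> parcs G" "(g 1, g 2) \<in> parcs G" "(g 2, g 1) \<in> parcs G"
      "(g 2, g 3) \<in> parcs G" "(g 4, g 3) \<in> parcs G" "(g 4, g 5) \<in> parcs G" "(g 5, g 4) \<in> parcs G"
      "(g 5, g 0) \<in> parcs G"
      by (simp_all add: adj k parcs_cycle_graph)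
    then show "\<exists>u \<in> ?Z. (z, u) \<in> parcs G"
      "(\<exists>t \<in> ?T. (z, t) \<in> parcs G) \<or> 2 \<le> card (nbrs G z - ?Z)" if "z \<in> ?Z" for z
      using that by auto
  qed
qed

end

section \<open>The characterization\<close>

theorem theorem4p3:
  fixes G :: "'a pair_pre_digraph" and n :: nat
  assumes "pair_graph G"
    and "connected (with_proj G)"
    and "card (pverts G) = n"
  shows "restrained_italian_number G = n \<longleftrightarrow>
    K\<^bsub>1\<^esub> (with_proj G) \<or>
    (n \<ge> 2 \<and> K\<^bsub>1,n - 1\<^esub> (with_proj G)) \<or>
    graph_iso G (cycle_graph 4) \<or>
    graph_iso G (cycle_graph 5) \<or>
    graph_iso G (path_graph 4) \<or>
    graph_iso G (path_graph 5) \<or>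
    graph_iso G (path_graph 6)"
    (is "_ \<longleftrightarrow> ?R")
proof
  interpret pair_graph G by fact
  note conn = assms(2) and n = assms(3)
  assume rn: "restrained_italian_number G = n"
  show ?R
  proof (cases "\<exists>c \<in> pverts G. \<forall>u \<in> nbrs G c. card (nbrs G u) < 2")
    case True
    then show ?thesis
      using star_or_singleton[OF conn] n by blast
  next
    case False
    \<comment> \<open>Every vertex now has a neighbour of degree at least 2, so a vertex of degree
      at least 3 would lie on an edge that allows a cheaper labelling.\<close>
    have deg: "card (nbrs G v) \<le> 2" if v: "v \<in> pverts G" for v
    proof (rule ccontr)
      assume "\<not> ?thesis"
      moreover obtain u where "(v, u) \<in> parcs G" "2 \<le> card (nbrs G u)"
        using False v by (force simp: nbrs_def)
      ultimately show False
        using restrained_italian_number_less_edge[of v u] rn n by simp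
    qed
    obtain k g where k: "0 < k" and g: "path_map k g" and bij: "bij_betw g {..<k} (pverts G)"
      and adj: "(\<forall>i<k. \<forall>j<k. (g i, g j) \<in> parcs G \<longleftrightarrow> (i, j) \<in> parcs (path_graph k)) \<or>
        3 \<le> k \<and> (\<forall>i<k. \<forall>j<k. (g i, g j) \<in> parcs G \<longleftrightarrow> (i, j) \<in> parcs (cycle_graph k))"
      using path_or_cycle[OF conn deg] by metis
    have le6: "k \<le> 6"
      using restrained_italian_number_less_path_map[OF g] rn n by linarith
    from adj show ?thesis
    proof
      assume P: "\<forall>i<k. \<forall>j<k. (g i, g j) \<in> parcs G \<longleftrightarrow> (i, j) \<in> parcs (path_graph k)"
      have iso: "graph_iso G (path_graph k)"
        unfolding graph_iso_iff[OF pair_wf_digraph_path_graph]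
        by (rule exI[of _ g]) (use bij P in \<open>auto simp: path_graph_def\<close>)
      \<comment> \<open>Paths on at most three vertices are stars or a single vertex: the neighbours
        of the vertex with index \<open>k div 2\<close> are all leaves, which the present case
        excludes.\<close>
      have "4 \<le> k"
      proof (rule ccontr)
        assume "\<not> 4 \<le> k"
        then have k3: "k = 1 \<or> k = 2 \<or> k = 3"
          using k by linarith
        have nbrs: "nbrs G (g i) = g ` {j. (i, j) \<in> parcs (path_graph k)}" if "i < k" for i
        proof -
          have "\<exists>j<k. w = g j" if "(g i, w) \<in> parcs G" for w
            using in_arcsD2[OF that] bij by (auto simp: bij_betw_def)
          then show ?thesis
            using P that by (fastforce simp: nbrs_def parcs_path_graph)
        qed
        have "card (nbrs G u) < 2" if u: "u \<in> nbrs G (g (k div 2))" for u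
        proof -
          obtain j where j: "(k div 2, j) \<in> parcs (path_graph k)" "u = g j"
            using u nbrs[of "k div 2"] k by auto
          then have "{l. (j, l) \<in> parcs (path_graph k)} = {k div 2}"
            using k3 by (auto simp: parcs_path_graph)
          then show ?thesis
            using j nbrs[of j] by (simp add: parcs_path_graph)
        qed
        then show False
          using False path_mapD(2)[OF g, of "k div 2"] k by auto
      qed
      then have "k = 4 \<or> k = 5 \<or> k = 6"
        using le6 by linarith
      then show ?thesis
        using iso by blast
    next
      assume C: "3 \<le> k \<and> (\<forall>i<k. \<forall>j<k. (g i, g j) \<in> parcs G \<longleftrightarrow> (i, j) \<in> parcs (cycle_graph k))"
      have iso: "graph_iso G (cycle_graph k)"
        unfolding graph_iso_iff[OF pair_wf_digraph_cycle_graph]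
        by (rule exI[of _ g]) (use bij C in \<open>auto simp: cycle_graph_def\<close>)
      have "\<not> (k = 3 \<or> k = 6)"
        using restrained_italian_number_less_cycle[OF g] C rn n by auto
      then have "k = 4 \<or> k = 5"
        using le6 C by linarith
      then show ?thesis
        using iso by blast
    qed
  qed
next
  interpret pair_graph G by fact
  assume R: ?R
  \<comment> \<open>Isomorphic graphs have equal order, so a lower bound by the order passes from
    \<open>H\<close> to \<open>G\<close>. The matching upper bound comes from the constant labelling
    1.\<close>
  have iso: "n \<le> restrained_italian_number G"
    if H: "pair_wf_digraph H" "graph_iso G H" "card (pverts H) \<le> restrained_italian_number H"
    for H :: "nat pair_pre_digraph"
  proof -
    have "card (pverts H) = n"
      using H(2) assms(3) bij_betw_same_card unfolding graph_iso_iff[OF H(1)] by blast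
    then show ?thesis
      using H(3) graph_iso_restrained_italian_number_le[OF H(1,2)] by simp
  qed
  have "card (pverts (path_graph k)) = k" "card (pverts (cycle_graph k)) = k" for k
    by (simp_all add: path_graph_def cycle_graph_def)
  then have "n \<le> restrained_italian_number G"
    using R iso[OF pair_wf_digraph_path_graph] iso[OF pair_wf_digraph_cycle_graph]
      restrained_italian_number_complete_1 restrained_italian_number_star assms(3)
      restrained_italian_number_path_graph_4 restrained_italian_number_path_graph_5
      restrained_italian_number_path_graph_6 restrained_italian_number_cycle_graph_4
      restrained_italian_number_cycle_graph_5
    by metis
  then show "restrained_italian_number G = n"
    using restrained_italian_number_le_card[of G] assms(3) by simp
qed

end
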